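(* Fix a field $\mathbb{F}$. Let $n,k$ be natural numbers with $k\in[n]$ and let $\mathbf{a}\in\{0,1\}^n_k$ be arbitrary. Then $\mathrm{ec}_{n,k}(\{0,1\}^n_k\setminus\{\mathbf{a}\})=\min\{k,n-k\}$.
   Context: $\{0,1\}^n_k\subseteq\mathbb{F}^n$ is the set of $0/1$ vectors of Hamming weight exactly $k$. A hyperplane is a set $\{\mathbf{x}\in\mathbb{F}^n:\ell(\mathbf{x})=0\}$ for a polynomial $\ell$ over $\mathbb{F}$ of degree exactly $1$. For $S\subseteq\{0,1\}^n_k$, $\mathrm{ec}_{n,k}(S)$ is the minimum number of hyperplanes in $\mathbb{F}^n$ whose union intersects $\{0,1\}^n_k$ exactly in $S$. *)

theory Defs
  imports "Jordan_Normal_Form.Matrix" "HOL-Library.Extended_Nat"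
begin

definition hamming_weight :: "'f::zero vec \<Rightarrow> nat" where
  "hamming_weight x = card {i. i < dim_vec x \<and> x $ i \<noteq> 0}"

definition slice :: "nat \<Rightarrow> nat \<Rightarrow> 'f::field vec set" where
  "slice n k = {x \<in> carrier_vec n. (\<forall>i<n. x $ i \<in> {0, 1}) \<and> hamming_weight x = k}"

text \<open>A polynomial in \<open>n\<close> variables of degree exactly 1 is \<open>w\<^sub>1 X\<^sub>1 + \<dots> + w\<^sub>n X\<^sub>n + c\<close>
  with at least one \<open>w\<^sub>i\<close> nonzero.\<close>

definition hyperplane :: "nat \<Rightarrow> 'f::field vec set \<Rightarrow> bool" where
  "hyperplane n h \<longleftrightarrow>
     (\<exists>w \<in> carrier_vec n. \<exists>c. w \<noteq> 0\<^sub>v n \<and> h = {x \<in> carrier_vec n. w \<bullet> x + c = 0})"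

definition exact_cover :: "nat \<Rightarrow> nat \<Rightarrow> 'f::field vec set \<Rightarrow> 'f vec set set \<Rightarrow> bool" where
  "exact_cover n k S H \<longleftrightarrow>
     finite H \<and> (\<forall>h\<in>H. hyperplane n h) \<and> \<Union>H \<inter> slice n k = S"

text \<open>Over a finite field some \<open>S\<close> have no exact cover; then the infimum is over the empty
  set and \<open>ec n k S = \<infinity>\<close>. A finite value is always attained. The empty family is admitted,
  so \<open>ec n k {} = 0\<close>.\<close>

definition ec :: "nat \<Rightarrow> nat \<Rightarrow> 'f::field vec set \<Rightarrow> enat" where
  "ec n k S = Inf {enat (card H) | H. exact_cover n k S H}"

end

theory Submission
  imports Defs
begin

text \<open>Let \<open>a\<close> be the indicator vector of \<open>A\<close>. The hyperplanes \<open>x\<^sub>i = 0\<close> with \<open>i \<in> A\<close>, and likewise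
  the hyperplanes \<open>x\<^sub>j = 1\<close> with \<open>j \<notin> A\<close>, cover exactly the slice without \<open>a\<close>.
  For the lower bound, choose \<open>r = min k (n - k)\<close> disjoint pairs \<open>(t, g t)\<close> with \<open>t \<in> A\<close> and
  \<open>g t \<notin> A\<close>. Exchanging the two coordinates of the pairs in \<open>T\<close>, for all \<open>T\<close>, embeds the cube
  \<open>{0,1}\<^sup>r\<close> in the slice with \<open>a\<close> at the origin. The product of the linear forms of an exact cover
  is there a polynomial that is nonzero only at the origin, so its alternating sum over the cube
  is nonzero; but such a sum vanishes for every polynomial of degree less than \<open>r\<close>.\<close>

text \<open>Adding or removing a fixed element \<open>t\<close> of \<open>R\<close> pairs off the
  subsets of \<open>R\<close>, and the two signs in each pair cancel.\<close>

lemma sum_Pow_minus_one_power: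
  assumes "finite R" "R \<noteq> {}"
  shows "(\<Sum>T\<in>Pow R. (-1) ^ card T) = (0::'a::comm_ring_1)"
proof -
  from assms obtain t R' where R: "R = insert t R'" "t \<notin> R'" "finite R'"
    by (metis finite_insert insertE mk_disjoint_insert ex_in_conv)
  have disj: "Pow R' \<inter> insert t ` Pow R' = {}" using R by auto
  have inj: "inj_on (insert t) (Pow R')"
    using R(2) by (intro inj_onI) (auto simp: insert_ident)
  have "(\<Sum>T\<in>Pow R'. (-1) ^ card (insert t T)) = (\<Sum>T\<in>Pow R'. - ((-1) ^ card T :: 'a))"
    using R by (intro sum.cong) (auto simp: card_insert_if finite_subset)
  then show ?thesis
    using R disj by (simp add: Pow_insert sum.union_disjoint sum.reindex[OF inj] sum_negf)
qed

text \<open>Induction on the factors. Expand one of them: its constant leaves the same sum with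
  fewer factors, and its coefficient at \<open>t\<close> leaves the sum over the sets containing
  \<open>t\<close>. Deleting \<open>t\<close> from these sets shifts the constants \<open>c\<close>
  and shrinks \<open>R\<close>, so both must vary in the induction.\<close>

lemma alternating_sum_prod_affine_eq_0:
  fixes c :: "'h \<Rightarrow> 'a::comm_ring_1" and v :: "'h \<Rightarrow> 'b \<Rightarrow> 'a"
  assumes "finite H" "finite R" "card H < card R"
  shows "(\<Sum>T\<in>Pow R. (-1) ^ card T * (\<Prod>h\<in>H. c h + (\<Sum>t\<in>T. v h t))) = 0"
  using assms
proof (induction H arbitrary: c R rule: finite_induct)
  case empty
  then show ?case by (auto intro: sum_Pow_minus_one_power)
next
  case (insert h H)
  define P where "P c T = (\<Prod>h\<in>H. c h + (\<Sum>t\<in>T. v h t))" for c :: "'h \<Rightarrow> 'a" and T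
  have fin: "finite T" if "T \<in> Pow R" for T using that insert.prems(1) by (auto intro: finite_subset)
  have link: "(\<Sum>T\<in>{T\<in>Pow R. t \<in> T}. (-1) ^ card T * P c T) = 0" if t: "t \<in> R" for t
  proof -
    \<comment> \<open>The contribution of the fixed element \<open>t\<close> is absorbed into the
      constants, so that the sum runs over subsets of \<open>R - {t}\<close>.\<close>
    let ?c' = "\<lambda>h. c h + v h t"
    have img: "{T\<in>Pow R. t \<in> T} = insert t ` Pow (R - {t})"
    proof (intro equalityI subsetI)
      fix T assume "T \<in> {T\<in>Pow R. t \<in> T}"
      then have "T = insert t (T - {t})" "T - {t} \<in> Pow (R - {t})" by auto
      then show "T \<in> insert t ` Pow (R - {t})" by (rule image_eqI)
    qed (use t in auto)
    have inj: "inj_on (insert t) (Pow (R - {t}))"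
      by (intro inj_onI) (metis Diff_iff PowD insert_ident singletonI subsetD)
    have "(\<Sum>T\<in>{T\<in>Pow R. t \<in> T}. (-1) ^ card T * P c T)
        = (\<Sum>T\<in>Pow (R - {t}). (-1) ^ card (insert t T) * P c (insert t T))"
      unfolding img by (simp add: sum.reindex[OF inj])
    also have "\<dots> = (\<Sum>T\<in>Pow (R - {t}). - ((-1) ^ card T * P ?c' T))"
    proof (rule sum.cong)
      fix T assume T: "T \<in> Pow (R - {t})"
      then have "finite T" "t \<notin> T" using fin by auto
      then show "(-1) ^ card (insert t T) * P c (insert t T) = - ((-1) ^ card T * P ?c' T)"
        by (simp add: P_def add.assoc)
    qed simp
    also have "\<dots> = - (\<Sum>T\<in>Pow (R - {t}). (-1) ^ card T * P ?c' T)"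
      by (rule sum_negf)
    \<comment> \<open>\<open>H\<close> and \<open>R\<close> have each lost one element, so the
      strict inequality of cardinalities survives.\<close>
    also have "\<dots> = 0"
      using insert.IH[of "R - {t}" ?c'] insert.prems insert.hyps t by (simp add: P_def)
    finally show ?thesis .
  qed
  \<comment> \<open>The inner sum over \<open>T\<close> becomes a conditional sum over all of
    \<open>R\<close>, whose range does not depend on \<open>T\<close>; the two summations can then
    be swapped.\<close>
  have "(\<Sum>T\<in>Pow R. (-1) ^ card T * (\<Prod>h\<in>insert h H. c h + (\<Sum>t\<in>T. v h t)))
      = (\<Sum>T\<in>Pow R. c h * ((-1) ^ card T * P c T)
          + (\<Sum>t\<in>R. if t \<in> T then v h t * ((-1) ^ card T * P c T) else 0))"
  proof (rule sum.cong)
    fix T assume T: "T \<in> Pow R"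
    have "(\<Sum>t\<in>R. if t \<in> T then v h t * ((-1) ^ card T * P c T) else 0)
        = (\<Sum>t\<in>T. v h t) * ((-1) ^ card T * P c T)"
      using T insert.prems(1)
      by (simp add: sum.inter_restrict[symmetric] Int_absorb1 sum_distrib_right)
    then show "(-1) ^ card T * (\<Prod>h\<in>insert h H. c h + (\<Sum>t\<in>T. v h t))
        = c h * ((-1) ^ card T * P c T)
          + (\<Sum>t\<in>R. if t \<in> T then v h t * ((-1) ^ card T * P c T) else 0)"
      using insert.hyps by (simp add: P_def algebra_simps)
  qed simp
  also have "\<dots> = c h * (\<Sum>T\<in>Pow R. (-1) ^ card T * P c T)
      + (\<Sum>t\<in>R. \<Sum>T\<in>Pow R. if t \<in> T then v h t * ((-1) ^ card T * P c T) else 0)"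
    by (simp add: sum.distrib sum_distrib_left sum.swap[of _ R])
  also have "(\<Sum>t\<in>R. \<Sum>T\<in>Pow R. if t \<in> T then v h t * ((-1) ^ card T * P c T) else 0)
      = (\<Sum>t\<in>R. v h t * (\<Sum>T\<in>{T\<in>Pow R. t \<in> T}. (-1) ^ card T * P c T))"
    unfolding sum_distrib_left using insert.prems(1)
    by (intro sum.cong refl sum.inter_filter[symmetric]) simp
  also have "\<dots> = 0" using link by simp
  also have "(\<Sum>T\<in>Pow R. (-1) ^ card T * P c T) = 0"
    using insert.IH[of R c] insert.prems insert.hyps by (simp add: P_def)
  finally show ?case by simp
qed

definition indicator_vec :: "nat \<Rightarrow> nat set \<Rightarrow> 'f::field vec" where
  "indicator_vec n S = vec n (\<lambda>i. of_bool (i \<in> S))"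

lemma indicator_vec_carrier [simp]: "indicator_vec n S \<in> carrier_vec n"
  by (simp add: indicator_vec_def)

lemma indicator_vec_index [simp]: "i < n \<Longrightarrow> indicator_vec n S $ i = of_bool (i \<in> S)"
  by (simp add: indicator_vec_def)

lemma indicator_vec_eq_iff:
  assumes "S \<subseteq> {..<n}" "T \<subseteq> {..<n}"
  shows "(indicator_vec n S :: 'f::field vec) = indicator_vec n T \<longleftrightarrow> S = T"
proof
  assume eq: "(indicator_vec n S :: 'f vec) = indicator_vec n T"
  have "i \<in> S \<longleftrightarrow> i \<in> T" if "i < n" for i
    using arg_cong[OF eq, of "\<lambda>x. x $ i"] that by (auto split: if_splits simp: of_bool_def)
  with assms show "S = T" by blast
qed simp

text \<open>This allows arguing with \<open>k\<close>-subsets of \<open>{..<n}\<close> in place of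
  vectors.\<close>

lemma slice_eq_indicator_vec:
  "(slice n k :: 'f::field vec set) = indicator_vec n ` {S. S \<subseteq> {..<n} \<and> card S = k}"
proof (intro equalityI subsetI)
  fix x :: "'f vec" assume x: "x \<in> slice n k"
  have "x = indicator_vec n {i. i < dim_vec x \<and> x $ i \<noteq> 0}"
    using x by (intro eq_vecI) (auto simp: slice_def indicator_vec_def)
  then show "x \<in> indicator_vec n ` {S. S \<subseteq> {..<n} \<and> card S = k}"
    using x by (intro image_eqI) (auto simp: slice_def hamming_weight_def)
next
  fix x :: "'f vec" assume "x \<in> indicator_vec n ` {S. S \<subseteq> {..<n} \<and> card S = k}"
  then obtain S where S: "x = indicator_vec n S" "S \<subseteq> {..<n}" "card S = k" by auto
  have "{i. i < dim_vec x \<and> x $ i \<noteq> 0} = S"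
    using S by (auto simp: indicator_vec_def)
  then show "x \<in> slice n k"
    using S by (auto simp: slice_def hamming_weight_def)
qed

lemma scalar_prod_indicator_vec:
  assumes "S \<subseteq> {..<n}"
  shows "w \<bullet> indicator_vec n S = (\<Sum>i\<in>S. w $ i)"
proof -
  have "w \<bullet> indicator_vec n S = (\<Sum>i<n. if i \<in> S then w $ i else 0)"
    unfolding scalar_prod_def by (rule sum.cong) (auto simp: indicator_vec_def)
  also have "\<dots> = sum (($) w) ({..<n} \<inter> S)"
    by (rule sum.inter_restrict[symmetric]) simp
  also have "{..<n} \<inter> S = S" using assms by auto
  finally show ?thesis .
qed

lemma hyperplane_coordinate:
  assumes "i < n"
  shows "hyperplane n {x \<in> carrier_vec n. x $ i = (b::'f::field)}"
proof -
  have "unit_vec n i \<noteq> (0\<^sub>v n :: 'f vec)"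
    using assms by (metis index_unit_vec(1) index_zero_vec(1) zero_neq_one)
  moreover have "{x \<in> carrier_vec n. x $ i = b} = {x \<in> carrier_vec n. unit_vec n i \<bullet> x + - b = 0}"
    using assms by auto
  ultimately show ?thesis
    unfolding hyperplane_def by (meson unit_vec_carrier)
qed

text \<open>Serves both upper bounds: \<open>b = 0\<close> with the support of the omitted vector,
  and \<open>b = 1\<close> with its complement.\<close>

lemma ec_le_card:
  assumes I: "I \<subseteq> {..<n}"
    and cover: "\<And>x. x \<in> slice n k \<Longrightarrow> (\<exists>i\<in>I. x $ i = b) \<longleftrightarrow> x \<in> S"
    and S: "S \<subseteq> slice n k"
  shows "ec n k (S :: 'f::field vec set) \<le> enat (card I)"
proof -
  let ?H = "(\<lambda>i. {x \<in> carrier_vec n. x $ i = b}) ` I"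
  have fin: "finite I" using I by (rule finite_subset) simp
  have "exact_cover n k S ?H"
    unfolding exact_cover_def
  proof (intro conjI ballI)
    show "\<Union>?H \<inter> slice n k = S"
      using cover S by (auto simp: slice_def)
  qed (use fin I hyperplane_coordinate in auto)
  then have "ec n k S \<le> enat (card ?H)"
    unfolding ec_def by (intro Inf_lower) auto
  also have "\<dots> \<le> enat (card I)" using card_image_le[OF fin] by simp
  finally show ?thesis .
qed

lemma exact_cover_card_ge:
  assumes A: "A \<subseteq> {..<n}" "card A = k"
    and H: "exact_cover n k (slice n k - {indicator_vec n A :: 'f::field vec}) H"
  shows "min k (n - k) \<le> card H"
proof (rule ccontr)
  assume less: "\<not> min k (n - k) \<le> card H"
  have finA: "finite A" using A(1) by (rule finite_subset) simp
  have cardB: "card ({..<n} - A) = n - k"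
    using A finA by (simp add: card_Diff_subset)
  \<comment> \<open>The minimum arises here: \<open>R\<close> must fit into \<open>A\<close>, of
    size \<open>k\<close>, and inject into its complement, of size \<open>n - k\<close>.\<close>
  obtain R where R: "R \<subseteq> A" "card R = min k (n - k)" "finite R"
    using A(2) by (metis min.cobounded1 obtain_subset_with_card_n)
  obtain g where g: "g ` R \<subseteq> {..<n} - A" "inj_on g R"
    using card_le_inj[of R "{..<n} - A"] R cardB by auto
  have "\<forall>h\<in>H. \<exists>w c. h = {x \<in> carrier_vec n. w \<bullet> x + c = 0}"
    using H unfolding exact_cover_def hyperplane_def by fast
  then obtain w c where wc: "\<And>h. h \<in> H \<Longrightarrow> h = {x \<in> carrier_vec n. w h \<bullet> x + c h = 0}"
    by metis
  have finH: "finite H" using H by (simp add: exact_cover_def)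
  \<comment> \<open>\<open>X T\<close> is \<open>A\<close> after exchanging the pairs in
    \<open>T\<close>. Each exchange changes the form of \<open>h\<close> by
    \<open>w h $ g t - w h $ t\<close>, independently of the others, so its value
    \<open>L h T\<close> has the affine shape that the alternating sum lemma expects.\<close>
  define X where "X T = A - T \<union> g ` T" for T
  define L where "L h T = (w h \<bullet> indicator_vec n A + c h) + (\<Sum>t\<in>T. w h $ g t - w h $ t)" for h T
  have X: "X T \<subseteq> {..<n}" "card (X T) = k" "\<And>h. w h \<bullet> indicator_vec n (X T) + c h = L h T"
    if T: "T \<subseteq> R" for T
  proof -
    have finT: "finite T" and TA: "T \<subseteq> A" using T R by (auto intro: finite_subset)
    have inj: "inj_on g T" using g(2) T by (rule inj_on_subset)
    have disj: "(A - T) \<inter> g ` T = {}" using g(1) T by auto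
    show sub: "X T \<subseteq> {..<n}" using A g T by (auto simp: X_def)
    have "card T \<le> card A" using card_mono[OF finA TA] .
    then show "card (X T) = k"
      using finA finT TA A(2)
      by (simp add: X_def card_Un_disjoint[OF _ _ disj] card_image[OF inj] card_Diff_subset)
    show "w h \<bullet> indicator_vec n (X T) + c h = L h T" for h
      unfolding scalar_prod_indicator_vec[OF sub] L_def scalar_prod_indicator_vec[OF A(1)]
      using finA finT
      by (simp add: X_def sum.union_disjoint[OF _ _ disj] sum.reindex[OF inj] sum_diff TA
          sum_subtractf)
  qed
  \<comment> \<open>In a field the product vanishes iff some hyperplane contains the point of
    \<open>X T\<close>; by exactness of the cover this means that the point is not the omitted
    one.\<close>
  have L0: "(\<Prod>h\<in>H. L h T) = 0 \<longleftrightarrow> T \<noteq> {}" if T: "T \<subseteq> R" for T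
  proof -
    let ?x = "indicator_vec n (X T) :: 'f vec"
    have slice: "?x \<in> slice n k"
      using X[OF T] by (auto simp: slice_eq_indicator_vec)
    have mem: "?x \<in> h \<longleftrightarrow> L h T = 0" if "h \<in> H" for h
      using wc[OF that] X(3)[OF T, of h] indicator_vec_carrier by (metis (mono_tags, lifting) mem_Collect_eq)
    have "(\<Prod>h\<in>H. L h T) = 0 \<longleftrightarrow> ?x \<in> \<Union>H"
      using finH mem by auto
    also have "\<dots> \<longleftrightarrow> ?x \<noteq> indicator_vec n A"
      using H slice unfolding exact_cover_def by blast
    also have "\<dots> \<longleftrightarrow> X T \<noteq> A"
      using indicator_vec_eq_iff[OF X(1)[OF T] A(1)] by simp
    also have "\<dots> \<longleftrightarrow> T \<noteq> {}"
    proof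
      assume "T \<noteq> {}"
      then obtain t where "t \<in> T" by auto
      then have "g t \<in> X T" "g t \<notin> A" using T g(1) by (auto simp: X_def)
      then show "X T \<noteq> A" by auto
    qed (auto simp: X_def)
    finally show ?thesis .
  qed
  have "(\<Sum>T\<in>Pow R. (-1) ^ card T * (\<Prod>h\<in>H. L h T)) = 0"
    unfolding L_def using finH R less by (intro alternating_sum_prod_affine_eq_0) auto
  moreover have "(\<Sum>T\<in>Pow R. (-1) ^ card T * (\<Prod>h\<in>H. L h T)) = (\<Prod>h\<in>H. L h {})"
  proof -
    have "(\<Sum>T\<in>Pow R - {{}}. (-1) ^ card T * (\<Prod>h\<in>H. L h T)) = 0"
    proof (rule sum.neutral, rule ballI)
      fix T assume "T \<in> Pow R - {{}}"
      then have "(\<Prod>h\<in>H. L h T) = 0" using L0[of T] by auto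
      then show "(-1) ^ card T * (\<Prod>h\<in>H. L h T) = 0" by (simp only: mult_zero_right)
    qed
    then show ?thesis using R(3) by (subst sum.remove[of _ "{}"]) auto
  qed
  ultimately show False using L0[of "{}"] by simp
qed

theorem theorem1p3:
  fixes n k :: nat and a :: "'f::field vec"
  assumes "k \<in> {1..n}"
    and "a \<in> slice n k"
  shows "ec n k (slice n k - {a}) = enat (min k (n - k))"
proof (rule antisym)
  obtain A where A: "a = indicator_vec n A" "A \<subseteq> {..<n}" "card A = k"
    using assms(2) by (auto simp: slice_eq_indicator_vec)
  have finA: "finite A" using A(2) by (rule finite_subset) simp
  \<comment> \<open>For finite sets of equal size, either inclusion forces equality. So a different
    vector of the slice has both a 0 inside \<open>A\<close> and a 1 outside it, which is what the
    two covers detect.\<close>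
  have neq: "indicator_vec n S \<noteq> a \<longleftrightarrow> \<not> A \<subseteq> S" "indicator_vec n S \<noteq> a \<longleftrightarrow> \<not> S \<subseteq> A"
    if "S \<subseteq> {..<n}" "card S = k" for S
  proof -
    have "finite S" using that(1) by (rule finite_subset) simp
    then have "A \<subseteq> S \<longleftrightarrow> S = A" "S \<subseteq> A \<longleftrightarrow> S = A"
      using that(2) A(3) finA card_subset_eq[of S A] card_subset_eq[of A S] by auto
    then show "indicator_vec n S \<noteq> a \<longleftrightarrow> \<not> A \<subseteq> S" "indicator_vec n S \<noteq> a \<longleftrightarrow> \<not> S \<subseteq> A"
      using A(1) indicator_vec_eq_iff[OF that(1) A(2)] by simp_all
  qed
  have "ec n k (slice n k - {a}) \<le> enat (card A)"
  proof (rule ec_le_card[where b = 0])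
    fix x :: "'f vec" assume "x \<in> slice n k"
    then obtain S where S: "x = indicator_vec n S" "S \<subseteq> {..<n}" "card S = k"
      by (auto simp: slice_eq_indicator_vec)
    have "(\<exists>i\<in>A. x $ i = 0) \<longleftrightarrow> \<not> A \<subseteq> S"
      using A(2) S(1) by (auto simp: subset_iff)
    then show "(\<exists>i\<in>A. x $ i = 0) \<longleftrightarrow> x \<in> slice n k - {a}"
      using neq(1)[OF S(2,3)] S(1) \<open>x \<in> slice n k\<close> by simp
  qed (use A in auto)
  \<comment> \<open>If \<open>k = n\<close>, the index set and the set to be covered are both empty,
    and the empty family gives the bound 0.\<close>
  moreover have "ec n k (slice n k - {a}) \<le> enat (card ({..<n} - A))"
  proof (rule ec_le_card[where b = 1])
    fix x :: "'f vec" assume "x \<in> slice n k"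
    then obtain S where S: "x = indicator_vec n S" "S \<subseteq> {..<n}" "card S = k"
      by (auto simp: slice_eq_indicator_vec)
    have "(\<exists>i\<in>{..<n} - A. x $ i = 1) \<longleftrightarrow> \<not> S \<subseteq> A"
      using S(1,2) by (auto simp: subset_iff)
    then show "(\<exists>i\<in>{..<n} - A. x $ i = 1) \<longleftrightarrow> x \<in> slice n k - {a}"
      using neq(2)[OF S(2,3)] S(1) \<open>x \<in> slice n k\<close> by simp
  qed auto
  moreover have "card ({..<n} - A) = n - k"
    using A finA by (simp add: card_Diff_subset)
  ultimately show "ec n k (slice n k - {a}) \<le> enat (min k (n - k))"
    using A(3) by (simp add: min_def)
  show "enat (min k (n - k)) \<le> ec n k (slice n k - {a})"
    unfolding ec_def using exact_cover_card_ge[OF A(2,3)] A(1)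
    by (intro Inf_greatest) auto
qed

end
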